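(* Epistemic Gödel Logic (the logic of all EGL-models) does not have the finite model property. Namely, consider the schema $\neg\neg B_a\neg\neg\varphi\to\neg\neg B_a\varphi$, where $\varphi$ ranges over all formulas and $a\in\mathcal A$ over all agents. (1) For every formula $\varphi$ and every agent $a$, the formula $\neg\neg B_a\neg\neg\varphi\to\neg\neg B_a\varphi$ is true in every EGL-model whose set of states $S$ is finite. (2) The schema is not valid: it is not true in the infinite model $M=(\mathbb N,r,\pi)$ where $r_a(i,j)=1$ for all $i,j\in\mathbb N$ and $V_i(\varphi)=\frac{1}{i+1}$ for all $i\in\mathbb N$.
   Context: Fix a set $\mathcal P$ of atomic propositions and a set $\mathcal A$ of agents. Formulas: $\varphi ::= p \mid \bot \mid \varphi\wedge\varphi \mid \varphi\to\varphi \mid B_a\varphi$ with $p\in\mathcal P$, $a\in\mathcal A$; $\neg\varphi$ abbreviates $\varphi\to\bot$. An EGL-model is $M=(S,(r_a)_{a\in\mathcal A},\pi)$ where $S$ is a non-empty countable set of states, each $r_a:S\times S\to[0,1]$, and $\pi:S\times\mathcal P\to[0,1]$. Values at a state $s\in S$: $V_s(p)=\pi(s,p)$; $V_s(\bot)=0$; $V_s(\varphi\wedge\psi)=\min\{V_s(\varphi),V_s(\psi)\}$; $V_s(\varphi\to\psi)=1$ if $V_s(\varphi)\le V_s(\psi)$ and $V_s(\varphi\to\psi)=V_s(\psi)$ otherwise; $V_s(B_a\varphi)=\inf_{s'\in S}\max\{1-r_a(s,s'),V_{s'}(\varphi)\}$. A formula $\varphi$ is true in $M$ if $V_s(\varphi)=1$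 for all $s\in S$; it is valid if it is true in all EGL-models. A schema is valid if all its instances are valid. The finite model property here means that every formula true in all EGL-models with finitely many states is valid. *)

theory Defs
  imports "HOL-Library.Countable_Set" Complex_Main
begin

text \<open>
  Atomic propositions and agents are the elements of the (arbitrary) types \<open>'p\<close> and \<open>'a\<close>.
\<close>

datatype ('p, 'a) fm =
    Atom 'p
  | Falsum
  | Conj "('p, 'a) fm" "('p, 'a) fm"
  | Impl "('p, 'a) fm" "('p, 'a) fm"
  | Bel 'a "('p, 'a) fm"

abbreviation Neg :: "('p, 'a) fm \<Rightarrow> ('p, 'a) fm" where
  "Neg \<phi> \<equiv> Impl \<phi> Falsum"

record ('s, 'a, 'p) egl_struct =
  states :: "'s set"
  acc :: "'a \<Rightarrow> 's \<Rightarrow> 's \<Rightarrow> real"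
  val :: "'s \<Rightarrow> 'p \<Rightarrow> real"

definition egl_model :: "('s, 'a, 'p) egl_struct \<Rightarrow> bool" where
  "egl_model M \<longleftrightarrow>
     states M \<noteq> {} \<and> countable (states M) \<and>
     (\<forall>a. \<forall>s\<in>states M. \<forall>t\<in>states M. acc M a s t \<in> {0..1}) \<and>
     (\<forall>s\<in>states M. \<forall>p. val M s p \<in> {0..1})"

primrec eval :: "('s, 'a, 'p) egl_struct \<Rightarrow> 's \<Rightarrow> ('p, 'a) fm \<Rightarrow> real" where
  "eval M s (Atom p) = val M s p"
| "eval M s Falsum = 0"
| "eval M s (Conj \<phi> \<psi>) = min (eval M s \<phi>) (eval M s \<psi>)"
| "eval M s (Impl \<phi> \<psi>) = (if eval M s \<phi> \<le> eval M s \<psi> then 1 else eval M s \<psi>)"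
| "eval M s (Bel a \<phi>) = (INF t\<in>states M. max (1 - acc M a s t) (eval M t \<phi>))"

text \<open>
  \<open>Inf\<close> on type \<open>real\<close> is only meaningful for non-empty sets that are bounded below; in an
  EGL-model every set of which \<open>eval\<close> takes the infimum is of this kind, because all values
  lie in the unit interval.
\<close>

lemma eval_unit_interval:
  assumes "egl_model M" "s \<in> states M"
  shows "eval M s \<phi> \<in> {0..1}"
  using assms(2)
proof (induction \<phi> arbitrary: s)
  case (Bel a \<phi>)
  let ?f = "\<lambda>t. max (1 - acc M a s t) (eval M t \<phi>)"
  have f: "0 \<le> ?f t \<and> ?f t \<le> 1" if "t \<in> states M" for t
  proof -
    have "acc M a s t \<in> {0..1}"
      using assms(1) Bel.prems that unfolding egl_model_def by blast
    moreover have "eval M t \<phi> \<in> {0..1}"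
      using that by (rule Bel.IH)
    ultimately show ?thesis by (simp add: le_max_iff_disj)
  qed
  have bdd: "bdd_below (?f ` states M)"
    using f by (intro bdd_belowI2[where m = 0]) blast
  have "0 \<le> Inf (?f ` states M)"
    using f Bel.prems by (intro cINF_greatest) blast+
  moreover have "Inf (?f ` states M) \<le> ?f s"
    using bdd Bel.prems by (rule cINF_lower)
  moreover from this have "Inf (?f ` states M) \<le> 1"
    using f[OF Bel.prems] by (meson order_trans)
  ultimately show ?case by (simp only: eval.simps atLeastAtMost_iff)
next
  case (Atom p)
  then show ?case
    using assms(1) by (simp add: egl_model_def)
next
  case (Conj \<phi> \<psi>)
  show ?case
    using Conj.IH(1)[OF Conj.prems] Conj.IH(2)[OF Conj.prems] by (simp add: min_le_iff_disj)
next
  case (Impl \<phi> \<psi>)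
  show ?case
    using Impl.IH(2)[OF Impl.prems] by simp
qed simp

definition true_in :: "('s, 'a, 'p) egl_struct \<Rightarrow> ('p, 'a) fm \<Rightarrow> bool" where
  "true_in M \<phi> \<longleftrightarrow> (\<forall>s\<in>states M. eval M s \<phi> = 1)"

text \<open>
  HOL cannot quantify over all state types inside a formula.  As state sets are countable, it
  suffices to quantify over models whose states are natural numbers; the lemmas
  \<open>valid_true_in\<close> and \<open>finitely_valid_true_in\<close> below show that nothing is lost.
\<close>

definition valid :: "('p, 'a) fm \<Rightarrow> bool" where
  "valid \<phi> \<longleftrightarrow> (\<forall>M :: (nat, 'a, 'p) egl_struct. egl_model M \<longrightarrow> true_in M \<phi>)"

definition finitely_valid :: "('p, 'a) fm \<Rightarrow> bool" where
  "finitely_valid \<phi> \<longleftrightarrow>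
     (\<forall>M :: (nat, 'a, 'p) egl_struct. egl_model M \<and> finite (states M) \<longrightarrow> true_in M \<phi>)"

definition finite_model_property :: "'p itself \<Rightarrow> 'a itself \<Rightarrow> bool" where
  "finite_model_property _ _ \<longleftrightarrow> (\<forall>\<phi> :: ('p, 'a) fm. finitely_valid \<phi> \<longrightarrow> valid \<phi>)"

definition schema :: "'a \<Rightarrow> ('p, 'a) fm \<Rightarrow> ('p, 'a) fm" where
  "schema a \<phi> = Impl (Neg (Neg (Bel a (Neg (Neg \<phi>))))) (Neg (Neg (Bel a \<phi>)))"

definition nat_copy :: "('s, 'a, 'p) egl_struct \<Rightarrow> (nat, 'a, 'p) egl_struct" where
  "nat_copy M =
     \<lparr>states = to_nat_on (states M) ` states M,
      acc = \<lambda>a i j. acc M a (from_nat_into (states M) i) (from_nat_into (states M) j),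
      val = \<lambda>i. val M (from_nat_into (states M) i)\<rparr>"

lemma egl_model_nat_copy: "egl_model M \<Longrightarrow> egl_model (nat_copy M)"
  by (auto simp: egl_model_def nat_copy_def)

lemma eval_nat_copy:
  assumes "egl_model M" "s \<in> states M"
  shows "eval (nat_copy M) (to_nat_on (states M) s) \<phi> = eval M s \<phi>"
  using assms(2)
proof (induction \<phi> arbitrary: s)
  case (Bel a \<phi>)
  have c: "countable (states M)"
    using assms(1) by (simp add: egl_model_def)
  let ?h = "to_nat_on (states M)"
  have acc: "acc (nat_copy M) a (?h s) (?h t) = acc M a s t" if "t \<in> states M" for t
    using c that Bel.prems by (simp add: nat_copy_def)
  have "states (nat_copy M) = ?h ` states M"
    by (simp add: nat_copy_def)
  then have "eval (nat_copy M) (?h s) (Bel a \<phi>) =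
      (INF t\<in>states M. max (1 - acc (nat_copy M) a (?h s) (?h t)) (eval (nat_copy M) (?h t) \<phi>))"
    by (simp add: image_image)
  also have "\<dots> = (INF t\<in>states M. max (1 - acc M a s t) (eval M t \<phi>))"
    by (intro arg_cong[where f = Inf] image_cong refl) (simp only: acc Bel.IH)
  finally show ?case by simp
next
  case (Atom p)
  then show ?case
    using assms(1) by (simp add: egl_model_def nat_copy_def)
qed simp_all

lemma true_in_nat_copy: "egl_model M \<Longrightarrow> true_in (nat_copy M) \<phi> \<longleftrightarrow> true_in M \<phi>"
proof -
  assume "egl_model M"
  moreover have "states (nat_copy M) = to_nat_on (states M) ` states M"
    by (simp add: nat_copy_def)
  ultimately show ?thesis
    by (simp add: true_in_def eval_nat_copy)
qed

lemma valid_true_in: "valid \<phi> \<Longrightarrow> egl_model M \<Longrightarrow> true_in M \<phi>"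
  using egl_model_nat_copy true_in_nat_copy unfolding valid_def by blast

lemma finitely_valid_true_in:
  assumes "finitely_valid \<phi>" "egl_model M" "finite (states M)"
  shows "true_in M \<phi>"
proof -
  have "finite (states (nat_copy M))"
    using assms(3) by (simp add: nat_copy_def)
  then show ?thesis
    using assms egl_model_nat_copy true_in_nat_copy unfolding finitely_valid_def by blast
qed

end

(*
  On values, a double negation is the indicator of being positive.  Hence the schema says that
  the infimum defining the value of B_a phi is positive as soon as its members are bounded away
  from 0 after replacing each positive value of phi by 1.  A finite infimum of positive numbers
  is attained, so it is positive; the infimum of 1 / (i + 1) is not.
*)
theory Submission
  imports Defs
begin

lemma eval_Neg_Neg: "eval M s (Neg (Neg \<phi>)) = (if eval M s \<phi> > 0 then 1 else 0)"
  by simp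

text \<open>Both sides of the schema are double negations, hence 0 or 1, and on these values the
  implication is the classical one. From here on only the positivity of the two belief values
  matters.\<close>

lemma eval_schema_eq_1_iff:
  "eval M s (schema a \<phi>) = 1 \<longleftrightarrow>
     (eval M s (Bel a (Neg (Neg \<phi>))) > 0 \<longrightarrow> eval M s (Bel a \<phi>) > 0)"
  unfolding schema_def eval.simps(4)[of M s "Neg (Neg _)"] eval_Neg_Neg by simp

text \<open>On \<open>real\<close>, an infimum is known to be a lower bound only if the set is
  bounded below; here \<open>eval_unit_interval\<close> yields the bound 0.\<close>

lemma eval_Bel_le:
  assumes "egl_model M" "s \<in> states M" "t \<in> states M"
  shows "eval M s (Bel a \<phi>) \<le> max (1 - acc M a s t) (eval M t \<phi>)"
proof -
  have "0 \<le> max (1 - acc M a s u) (eval M u \<phi>)" if "u \<in> states M" for u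
    using eval_unit_interval[OF assms(1) that, of \<phi>] by (simp add: le_max_iff_disj)
  then have "bdd_below ((\<lambda>u. max (1 - acc M a s u) (eval M u \<phi>)) ` states M)"
    by (intro bdd_belowI2[where m = 0])
  then show ?thesis
    unfolding eval.simps using assms(3) by (rule cINF_lower)
qed

lemma true_in_schema_finite:
  assumes M: "egl_model M" and fin: "finite (states M)"
  shows "true_in M (schema a \<phi>)"
  unfolding true_in_def eval_schema_eq_1_iff
proof (intro ballI impI)
  fix s assume s: "s \<in> states M" and pos: "eval M s (Bel a (Neg (Neg \<phi>))) > 0"
  let ?f = "\<lambda>t. max (1 - acc M a s t) (eval M t \<phi>)"
  have "?f t > 0" if t: "t \<in> states M" for t
  proof -
    have "0 < max (1 - acc M a s t) (eval M t (Neg (Neg \<phi>)))"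
      using pos eval_Bel_le[OF M s t] by (rule less_le_trans)
    \<comment> \<open>Either \<open>1 - acc M a s t\<close> is positive, which does not involve the
      formula, or the double negation is positive at \<open>t\<close>, and then so is
      \<phi>.\<close>
    then show ?thesis
      unfolding eval_Neg_Neg by (auto simp: less_max_iff_disj split: if_splits)
  qed
  \<comment> \<open>The state \<open>s\<close> itself shows that the image is non-empty, as
    \<open>Min\<close> requires.\<close>
  moreover have "Inf (?f ` states M) = Min (?f ` states M)"
    using s fin by (intro cInf_eq_Min) auto
  moreover have "Min (?f ` states M) \<in> ?f ` states M"
    using s fin by (intro Min_in) auto
  ultimately have "Inf (?f ` states M) > 0"
    by (elim imageE) (simp only:)
  then show "eval M s (Bel a \<phi>) > 0"
    by (simp only: eval.simps)
qed

lemma not_true_in_schema_harmonic: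
  fixes M :: "(nat, 'a, 'p) egl_struct"
  assumes M: "egl_model M" and univ: "states M = UNIV" and acc: "\<And>i j. acc M a i j = 1"
    and harm: "\<And>i. eval M i \<phi> = 1 / (real i + 1)"
  shows "\<not> true_in M (schema a \<phi>)"
proof -
  \<comment> \<open>As \<phi> is positive at every state, this is the infimum of the constant
    1.\<close>
  have "eval M 0 (Bel a (Neg (Neg \<phi>))) = 1"
    by (simp add: univ acc harm)
  moreover have "\<not> eval M 0 (Bel a \<phi>) > 0"
  proof
    assume "eval M 0 (Bel a \<phi>) > 0"
    \<comment> \<open>\<open>inverse (real (Suc n))\<close> is the value of \<phi> at state
      \<open>n\<close>. Full accessibility makes it a member of the infimum, so it cannot lie below
      that infimum.\<close>
    then obtain n where "inverse (real (Suc n)) < eval M 0 (Bel a \<phi>)"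
      using reals_Archimedean by blast
    moreover have "eval M 0 (Bel a \<phi>) \<le> inverse (real (Suc n))"
      using eval_Bel_le[OF M, of 0 n a \<phi>] unfolding univ acc harm
      by (simp add: inverse_eq_divide add.commute del: eval.simps)
    ultimately show False by simp
  qed
  ultimately have "eval M 0 (schema a \<phi>) \<noteq> 1"
    unfolding eval_schema_eq_1_iff by simp
  then show ?thesis
    unfolding true_in_def univ by blast
qed

text \<open>The valuation ignores the atom and the accessibility ignores the agent, so any atom and
  any agent give a counterexample.\<close>

definition harmonic_model :: "(nat, 'a, 'p) egl_struct" where
  "harmonic_model = \<lparr>states = UNIV, acc = \<lambda>_ _ _. 1, val = \<lambda>i _. 1 / (real i + 1)\<rparr>"

lemma harmonic_model:
  shows egl_model_harmonic_model: "egl_model harmonic_model"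
    and states_harmonic_model: "states harmonic_model = UNIV"
    and acc_harmonic_model: "acc harmonic_model a i j = 1"
    and eval_harmonic_model: "eval harmonic_model i (Atom p) = 1 / (real i + 1)"
  by (simp_all add: harmonic_model_def egl_model_def)

lemma not_true_in_harmonic_model: "\<not> true_in harmonic_model (schema a (Atom p))"
  by (rule not_true_in_schema_harmonic) (fact harmonic_model)+

lemma not_valid_schema_Atom: "\<not> valid (schema a (Atom p))"
  using egl_model_harmonic_model not_true_in_harmonic_model unfolding valid_def by iprover

lemma finitely_valid_schema: "finitely_valid (schema a \<phi>)"
  by (simp add: finitely_valid_def true_in_schema_finite)

theorem mainTheorem8:
  shows "\<not> finite_model_property TYPE('p) TYPE('a) \<and>
    (\<forall>(\<phi> :: ('p, 'a) fm) (a :: 'a) (M :: ('s, 'a, 'p) egl_struct).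
       egl_model M \<and> finite (states M) \<longrightarrow> true_in M (schema a \<phi>)) \<and>
    \<not> (\<forall>(\<phi> :: ('p, 'a) fm) (a :: 'a). valid (schema a \<phi>)) \<and>
    (\<forall>(\<phi> :: ('p, 'a) fm) (a :: 'a) (M :: (nat, 'a, 'p) egl_struct).
       egl_model M \<and> states M = UNIV \<and> (\<forall>i j. acc M a i j = 1) \<and>
       (\<forall>i. eval M i \<phi> = 1 / (real i + 1)) \<longrightarrow> \<not> true_in M (schema a \<phi>)) \<and>
    (\<exists>(\<phi> :: ('p, 'a) fm) (M :: (nat, 'a, 'p) egl_struct).
       egl_model M \<and> states M = UNIV \<and> (\<forall>a i j. acc M a i j = 1) \<and>
       (\<forall>i. eval M i \<phi> = 1 / (real i + 1)) \<and> (\<forall>a. \<not> true_in M (schema a \<phi>)))"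
proof (intro conjI)
  \<comment> \<open>Types are non-empty, so \<open>undefined\<close> serves as some agent and some
    atom.\<close>
  show "\<not> finite_model_property TYPE('p) TYPE('a)"
    using finitely_valid_schema[of undefined "Atom undefined :: ('p, 'a) fm"]
      not_valid_schema_Atom[of "undefined :: 'a" "undefined :: 'p"]
    unfolding finite_model_property_def by iprover
  show "\<forall>(\<phi> :: ('p, 'a) fm) (a :: 'a) (M :: ('s, 'a, 'p) egl_struct).
      egl_model M \<and> finite (states M) \<longrightarrow> true_in M (schema a \<phi>)"
    by (intro allI impI true_in_schema_finite) (elim conjE, assumption)+
  show "\<not> (\<forall>(\<phi> :: ('p, 'a) fm) (a :: 'a). valid (schema a \<phi>))"
    using not_valid_schema_Atom[of "undefined :: 'a" "undefined :: 'p"] by iprover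
  show "\<forall>(\<phi> :: ('p, 'a) fm) (a :: 'a) (M :: (nat, 'a, 'p) egl_struct).
      egl_model M \<and> states M = UNIV \<and> (\<forall>i j. acc M a i j = 1) \<and>
      (\<forall>i. eval M i \<phi> = 1 / (real i + 1)) \<longrightarrow> \<not> true_in M (schema a \<phi>)"
    by (intro allI impI, elim conjE, rule not_true_in_schema_harmonic) simp_all
  show "\<exists>(\<phi> :: ('p, 'a) fm) (M :: (nat, 'a, 'p) egl_struct).
      egl_model M \<and> states M = UNIV \<and> (\<forall>a i j. acc M a i j = 1) \<and>
      (\<forall>i. eval M i \<phi> = 1 / (real i + 1)) \<and> (\<forall>a. \<not> true_in M (schema a \<phi>))"
    by (intro exI[of _ "Atom undefined"] exI[of _ harmonic_model] conjI allI
        harmonic_model not_true_in_harmonic_model)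
qed

end
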